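(* Let $n\ge 17$ be a square-free integer with $n\equiv 1\pmod 4$, let $F=\mathbb{Q}(\sqrt{n})$ and let $\mathcal{O}_F$ be its ring of integers. Then $g_{\mathcal{O}_F}(2)\ge 7$. In particular, let \begin{align*} \phi(X,Y)&=\Bigl(7+\bigl(\tfrac{1+\sqrt{n}}{2}\bigr)^2\Bigr)X^2+\Bigl(\tfrac{5+\sqrt{n}}{2}X+Y\Bigr)^2+\Bigl((5+\sqrt{n})X+\tfrac{1+\sqrt{n}}{2}Y\Bigr)^2\\ &=\frac{3n+77+26\sqrt{n}}{2}X^2+(10+n+7\sqrt{n})XY+\frac{n+5+2\sqrt{n}}{4}Y^2 . \end{align*} Then $\phi$ is a sum of $7$, but not of $6$, squares of binary linear forms over $\mathcal{O}_F$.
   Context: For a commutative ring $R$ with unity and a positive integer $r$, let $\Sigma_R(r)$ be the set of all quadratic forms (homogeneous polynomials of degree $2$) in $R[X_1,\dots,X_r]$ that can be written as a sum of finitely many squares of linear forms (homogeneous polynomials of degree $1$) in $R[X_1,\dots,X_r]$. Then $g_R(r)$ is the smallest $n\in\mathbb{N}$ such that every form in $\Sigma_R(r)$ is a sum of $n$ squares of linear forms over $R$ (zero linear forms allowed); $g_R(r)=\infty$ if no such $n$ exists. A binary linear form over $\mathcal{O}_F$ is a polynomial $aX+bY$ with $a,b\in\mathcal{O}_F$. *)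

theory Defs
  imports
    Complex_Main
    "HOL-Library.Poly_Mapping"
    "HOL-Library.Extended_Nat"
    "HOL-Computational_Algebra.Polynomial"
    "HOL-Computational_Algebra.Squarefree"
    "HOL-Number_Theory.Cong"
begin

text \<open>
  A multivariate polynomial with coefficients of type \<open>'a\<close> is a finitely supported map
  from monomials to coefficients, and a monomial is a finitely supported map from variable
  indices to exponents. Multiplication in \<^theory>\<open>HOL-Library.Poly_Mapping\<close> is
  convolution, so this type carries the usual polynomial ring structure.
\<close>

type_synonym 'a mpolynomial = "(nat \<Rightarrow>\<^sub>0 nat) \<Rightarrow>\<^sub>0 'a"

definition Const :: "'a::comm_ring_1 \<Rightarrow> 'a mpolynomial" where
  "Const c = Poly_Mapping.single 0 c"

definition Var :: "nat \<Rightarrow> 'a::comm_ring_1 mpolynomial" where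
  "Var i = Poly_Mapping.single (Poly_Mapping.single i 1) 1"

definition total_degree :: "(nat \<Rightarrow>\<^sub>0 nat) \<Rightarrow> nat" where
  "total_degree m = (\<Sum>i\<in>Poly_Mapping.keys m. Poly_Mapping.lookup m i)"

text \<open>
  The coefficient ring is a subring \<open>R\<close> of the ambient commutative ring \<open>'a\<close>
  (take \<open>R = UNIV\<close> for \<open>'a\<close> itself). \<open>forms R r d\<close> consists of the homogeneous
  polynomials of degree \<open>d\<close> in $R[X_1,\dots,X_r]$; the zero polynomial is one of them.
\<close>

definition forms :: "'a::comm_ring_1 set \<Rightarrow> nat \<Rightarrow> nat \<Rightarrow> 'a mpolynomial set" where
  "forms R r d = {p. (\<forall>m. Poly_Mapping.lookup p m \<in> R) \<and>
     (\<forall>m\<in>Poly_Mapping.keys p. Poly_Mapping.keys m \<subseteq> {1..r} \<and> total_degree m = d)}"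

definition sum_of_squares_of_linear_forms ::
    "'a::comm_ring_1 set \<Rightarrow> nat \<Rightarrow> nat \<Rightarrow> 'a mpolynomial \<Rightarrow> bool" where
  "sum_of_squares_of_linear_forms R r k p \<longleftrightarrow>
     (\<exists>l. (\<forall>i<k. l i \<in> forms R r 1) \<and> p = (\<Sum>i<k. (l i)\<^sup>2))"

definition Sigma_forms :: "'a::comm_ring_1 set \<Rightarrow> nat \<Rightarrow> 'a mpolynomial set" where
  "Sigma_forms R r = {p \<in> forms R r 2. \<exists>k. sum_of_squares_of_linear_forms R r k p}"

text \<open>The infimum of the empty set in \<^typ>\<open>enat\<close> is \<open>\<infinity>\<close>.\<close>

definition g_invariant :: "'a::comm_ring_1 set \<Rightarrow> nat \<Rightarrow> enat" where
  "g_invariant R r =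
     (INF k\<in>{k. \<forall>p\<in>Sigma_forms R r. sum_of_squares_of_linear_forms R r k p}. enat k)"

definition is_subfield :: "'a::field set \<Rightarrow> bool" where
  "is_subfield K \<longleftrightarrow> 1 \<in> K \<and> (\<forall>x\<in>K. \<forall>y\<in>K. x - y \<in> K \<and> x * y \<in> K) \<and>
     (\<forall>x\<in>K. inverse x \<in> K)"

text \<open>$\mathbb{Q}(\sqrt n)$, as the smallest subfield of the reals containing $\sqrt n$
  (used for \<open>n \<ge> 0\<close>).\<close>

definition real_quadratic_field :: "int \<Rightarrow> real set" where
  "real_quadratic_field n = is_subfield hull {sqrt n}"

definition ring_of_integers :: "'a::field_char_0 set \<Rightarrow> 'a set" where
  "ring_of_integers F = {x \<in> F. algebraic_int x}"

definition \<phi> :: "int \<Rightarrow> real mpolynomial" where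
  "\<phi> n = (let X = Var 1; Y = Var 2 in
     Const (7 + ((1 + sqrt n) / 2)\<^sup>2) * X\<^sup>2
     + (Const ((5 + sqrt n) / 2) * X + Y)\<^sup>2
     + (Const (5 + sqrt n) * X + Const ((1 + sqrt n) / 2) * Y)\<^sup>2)"


subsection \<open>Basic facts\<close>

lemma is_subfield_Inter: "(\<And>K. K \<in> T \<Longrightarrow> is_subfield K) \<Longrightarrow> is_subfield (\<Inter>T)"
  unfolding is_subfield_def by blast

lemma is_subfield_add:
  assumes "is_subfield K" "x \<in> K" "y \<in> K"
  shows "x + y \<in> K"
proof -
  have "0 - y \<in> K"
    using assms unfolding is_subfield_def by (metis diff_self)
  then have "x - (0 - y) \<in> K"
    using assms unfolding is_subfield_def by blast
  then show ?thesis by simp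
qed

lemma is_subfield_Rats:
  fixes K :: "real set"
  assumes K: "is_subfield K"
  shows "\<rat> \<subseteq> K"
proof
  have nat: "of_nat k \<in> K" for k
  proof (induction k)
    case 0
    then show ?case using K unfolding is_subfield_def by (metis diff_self of_nat_0)
  next
    case (Suc k)
    then show ?case using K is_subfield_add[OF K, of 1 "of_nat k"]
      by (auto simp: is_subfield_def)
  qed
  have int: "of_int i \<in> K" for i
  proof (cases i rule: int_cases)
    case (nonneg k)
    then show ?thesis using nat by simp
  next
    case (neg k)
    have "of_nat 0 - of_nat (Suc k) \<in> K"
      using nat[of 0] nat[of "Suc k"] K unfolding is_subfield_def by blast
    then show ?thesis using neg by simp
  qed
  fix x :: real assume "x \<in> \<rat>"
  then obtain a b :: int where "x = of_int a / of_int b"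
    by (metis Rats_cases')
  then show "x \<in> K"
    using K int[of a] int[of b] unfolding is_subfield_def divide_inverse by blast
qed

lemma real_quadratic_field_eq:
  assumes "n \<ge> 0"
  shows "real_quadratic_field n = {a + b * sqrt n | a b. a \<in> \<rat> \<and> b \<in> \<rat>}"
    (is "_ = ?Q")
  unfolding real_quadratic_field_def
proof (rule hull_unique)
  have "0 + 1 * sqrt n \<in> ?Q"
    using Rats_0 Rats_1 by blast
  then show "{sqrt n} \<subseteq> ?Q" by simp
next
  have QI: "a + b * sqrt n \<in> ?Q" if "a \<in> \<rat>" "b \<in> \<rat>" for a b
    using that by blast
  have sq: "sqrt n * sqrt n = of_int n" using assms by simp
  have one: "1 \<in> ?Q"
    using QI[of 1 0] by simp
  have ring: "x - y \<in> ?Q \<and> x * y \<in> ?Q" if xy: "x \<in> ?Q" "y \<in> ?Q" for x y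
  proof -
    obtain a b c d where *: "x = a + b * sqrt n" "y = c + d * sqrt n"
      "a \<in> \<rat>" "b \<in> \<rat>" "c \<in> \<rat>" "d \<in> \<rat>"
      using xy by blast
    have d: "x - y = (a - c) + (b - d) * sqrt n" using * by (simp add: algebra_simps)
    have "x * y = a * c + b * d * (sqrt n * sqrt n) + (a * d + b * c) * sqrt n"
      using * by (simp add: algebra_simps)
    then have m: "x * y = (a * c + b * d * of_int n) + (a * d + b * c) * sqrt n"
      unfolding sq .
    have "a - c \<in> \<rat>" "b - d \<in> \<rat>" "a * c + b * d * of_int n \<in> \<rat>" "a * d + b * c \<in> \<rat>"
      using * by simp_all
    then show ?thesis unfolding d m using QI by simp
  qed
  have inv: "inverse x \<in> ?Q" if x: "x \<in> ?Q" for x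
  proof -
    obtain a b where *: "x = a + b * sqrt n" "a \<in> \<rat>" "b \<in> \<rat>"
      using x by blast
    define N where "N = a\<^sup>2 - b\<^sup>2 * of_int n"
    have N: "N \<in> \<rat>" unfolding N_def using * by simp
    have "x * (a - b * sqrt n) = a\<^sup>2 - b\<^sup>2 * (sqrt n * sqrt n)"
      using * by (simp add: algebra_simps power2_eq_square)
    then have xN: "x * (a - b * sqrt n) = N"
      unfolding sq N_def .
    show ?thesis
    proof (cases "N = 0")
      case False
      then have "x \<noteq> 0" using xN by auto
      then have "inverse x = (a - b * sqrt n) / N"
        using False xN by (simp add: field_simps)
      also have "\<dots> = a / N + (- b / N) * sqrt n" by (simp add: diff_divide_distrib)
      finally have i: "inverse x = a / N + (- b / N) * sqrt n" .
      have "a / N \<in> \<rat>" "- b / N \<in> \<rat>" using N * by simp_all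
      then show ?thesis unfolding i by (rule QI)
    next
      case True
      have "x \<in> \<rat>"
      proof (cases "x = 0")
        case False
        then have "a = b * sqrt n" using xN True by simp
        then have "x = 2 * a" using *(1) by simp
        then show ?thesis using *(2) by simp
      qed simp
      then have "inverse x \<in> \<rat>" by simp
      then show ?thesis using QI[of "inverse x" 0] by simp
    qed
  qed
  show "is_subfield ?Q"
    unfolding is_subfield_def by (intro conjI[OF one] conjI ballI ring inv)
next
  fix K assume "{sqrt n} \<subseteq> K" and K: "is_subfield K"
  then have s: "sqrt n \<in> K" by simp
  show "?Q \<subseteq> K"
  proof
    fix x assume "x \<in> ?Q"
    then obtain a b where *: "x = a + b * sqrt n" "a \<in> \<rat>" "b \<in> \<rat>"
      by blast
    then have "a \<in> K" "b \<in> K" using is_subfield_Rats[OF K] by blast+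
    then have "b * sqrt n \<in> K" using s K unfolding is_subfield_def by blast
    then show "x \<in> K" unfolding *(1) by (rule is_subfield_add[OF K \<open>a \<in> K\<close>])
  qed
qed

lemma total_degree_eq_1_iff: "total_degree m = 1 \<longleftrightarrow> (\<exists>i. m = Poly_Mapping.single i 1)"
proof
  assume "total_degree m = 1"
  then have "(\<Sum>i\<in>Poly_Mapping.keys m. Poly_Mapping.lookup m i) = Suc 0"
    by (simp add: total_degree_def)
  then obtain i where i: "i \<in> Poly_Mapping.keys m" "Poly_Mapping.lookup m i = Suc 0"
      "\<forall>j\<in>Poly_Mapping.keys m. i \<noteq> j \<longrightarrow> Poly_Mapping.lookup m j = 0"
    by (auto simp: sum_eq_Suc0_iff)
  have "Poly_Mapping.lookup m j = Poly_Mapping.lookup (Poly_Mapping.single i 1) j" for j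
    using i by (cases "j = i") (auto simp: lookup_single_not_eq in_keys_iff)
  then show "\<exists>i. m = Poly_Mapping.single i 1"
    by (meson poly_mapping_eqI)
qed (auto simp: total_degree_def)

text \<open>The binary linear forms are exactly the polynomials $aX + bY$ with $a, b \in R$.\<close>

lemma forms_2_1_eq:
  fixes R :: "'a::comm_ring_1 set"
  assumes "0 \<in> R"
  shows "forms R 2 1 = {Const a * Var 1 + Const b * Var 2 | a b. a \<in> R \<and> b \<in> R}"
proof -
  let ?x = "\<lambda>i::nat. Poly_Mapping.single i (1::nat)"
  have lk: "Poly_Mapping.lookup (Const a * Var 1 + Const b * Var 2) m
      = (if m = ?x 1 then a else if m = ?x 2 then b else 0)" for a b :: 'a and m
  proof -
    have "?x 1 \<noteq> ?x 2"
    proof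
      assume "?x 1 = ?x 2"
      then have "Poly_Mapping.lookup (?x 1) 1 = Poly_Mapping.lookup (?x 2) 1" by (rule arg_cong)
      then show False by (simp add: lookup_single)
    qed
    then show ?thesis
      by (auto simp: Const_def Var_def mult_single lookup_add lookup_single when_def)
  qed
  show ?thesis
  proof (intro equalityI subsetI)
    fix p assume p: "p \<in> forms R 2 1"
    let ?a = "Poly_Mapping.lookup p (?x 1)" and ?b = "Poly_Mapping.lookup p (?x 2)"
    have supp: "m = ?x 1 \<or> m = ?x 2" if "Poly_Mapping.lookup p m \<noteq> 0" for m
    proof -
      have "m \<in> Poly_Mapping.keys p" using that by (simp add: in_keys_iff)
      then have m: "Poly_Mapping.keys m \<subseteq> {1..2}" "total_degree m = 1"
        using p by (auto simp: forms_def)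
      then obtain i where i: "m = ?x i" using total_degree_eq_1_iff by blast
      then have "i \<in> {1..2}" using m by simp
      then have "i = 1 \<or> i = 2" by auto
      then show ?thesis using i by blast
    qed
    have "p = Const ?a * Var 1 + Const ?b * Var 2"
    proof (rule poly_mapping_eqI)
      fix m
      show "Poly_Mapping.lookup p m
          = Poly_Mapping.lookup (Const ?a * Var 1 + Const ?b * Var 2) m"
        unfolding lk using supp[of m] by auto
    qed
    moreover have "?a \<in> R" "?b \<in> R" using p by (auto simp: forms_def)
    ultimately show "p \<in> {Const a * Var 1 + Const b * Var 2 | a b. a \<in> R \<and> b \<in> R}"
      by blast
  next
    fix p assume "p \<in> {Const a * Var 1 + Const b * Var 2 | a b. a \<in> R \<and> b \<in> R}"
    then obtain a b where p: "p = Const a * Var 1 + Const b * Var 2" "a \<in> R" "b \<in> R"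
      by blast
    have "Poly_Mapping.lookup p m \<in> R" for m
      unfolding p(1) lk using p(2,3) assms by simp
    moreover have "Poly_Mapping.keys m \<subseteq> {1..2} \<and> total_degree m = 1"
      if "m \<in> Poly_Mapping.keys p" for m
    proof -
      have "m = ?x 1 \<or> m = ?x 2"
        using that unfolding in_keys_iff p(1) lk by (metis (full_types))
      then show ?thesis by (auto simp: total_degree_def)
    qed
    ultimately show "p \<in> forms R 2 1"
      unfolding forms_def by blast
  qed
qed

end

theory Submission
  imports Defs
begin

text \<open>
  Write $\omega = (1+\sqrt n)/2$ and suppose $\phi = \sum_{i<6} (x_i X + y_i Y)^2$. Since
  $\sum y_i^2 = 1 + \omega^2$ and $n \ge 17$, comparing rational and irrational parts forces
  $y = (\omega, 1, 0, 0, 0, 0)$ up to order and signs. The coefficient of $XY$ then leaves one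
  parameter for $(x_1, x_2)$, and positivity of the trace of $x_3^2 + \dots + x_6^2$ leaves only four
  values of it, for which this sum of four squares equals $2\omega^2 - 2$, $\omega^2 + 7$,
  $14 - 2\omega^2$ or $\omega^2 - 13$. If $\sum (p_i + q_i \sqrt n)^2/4$ is one of these, then
  $\sum p_i q_i \equiv \sum q_i^2 \pmod 2$ rules it out by size, except for $\omega^2 + 7$, where it
  reduces to the fact that $7$ is not a sum of three integer squares.
  Seven squares suffice because $7 = 2^2 + 1 + 1 + 1$.
\<close>

subsection \<open>The integer system\<close>

lemma sum_squares_eq_1E:
  fixes f :: "'a \<Rightarrow> int"
  assumes "finite I" "(\<Sum>i\<in>I. (f i)\<^sup>2) = 1"
  obtains j where "j \<in> I" "(f j)\<^sup>2 = 1" "\<And>i. i \<in> I - {j} \<Longrightarrow> f i = 0"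
proof -
  obtain j where j: "j \<in> I" "f j \<noteq> 0"
    using assms by (metis (no_types, lifting) sum.neutral zero_neq_one zero_eq_power2)
  have s: "(f j)\<^sup>2 + (\<Sum>i\<in>I - {j}. (f i)\<^sup>2) = 1"
    using assms j by (simp add: sum.remove)
  have "(f j)\<^sup>2 \<ge> 1" "(\<Sum>i\<in>I - {j}. (f i)\<^sup>2) \<ge> 0"
    using j(2) by (simp_all add: sum_nonneg int_one_le_iff_zero_less)
  then have "(f j)\<^sup>2 = 1" "(\<Sum>i\<in>I - {j}. (f i)\<^sup>2) = 0" using s by linarith+
  moreover have "f i = 0" if "i \<in> I - {j}" for i
    using that calculation(2) assms(1) by (simp add: sum_nonneg_eq_0_iff)
  ultimately show ?thesis using that j(1) by blast
qed

text \<open>The two sums differ by the sum of the even terms \<open>(f i - g i) * g i\<close>. For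
  quadratic integers (f i + g i sqrt n)/2 this ties the irrational part of a sum of squares to the
  sum of the (g i)^2, which is the part weighted by n.\<close>

lemma even_sum_mult_iff:
  fixes f g :: "'a \<Rightarrow> int"
  assumes "\<And>i. i \<in> I \<Longrightarrow> even (f i - g i)"
  shows "even (\<Sum>i\<in>I. f i * g i) \<longleftrightarrow> even (\<Sum>i\<in>I. (g i)\<^sup>2)"
proof -
  have "even (\<Sum>i\<in>I. f i * g i - (g i)\<^sup>2)"
    by (rule dvd_sum) (use assms in \<open>auto simp: power2_eq_square\<close>)
  then show ?thesis by (simp add: sum_subtractf)
qed

text \<open>Parity makes the sum of the (g i)^2 odd, so the bound 3 leaves only the value 1. In
  terms of (f i + g i sqrt n)/2, one element is omega or -omega and all others are rational
  integers.\<close>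

lemma sum_mult_eq_1_imp:
  fixes f g :: "'a \<Rightarrow> int"
  assumes "finite I" and par: "\<forall>i\<in>I. even (f i - g i)"
    and one: "(\<Sum>i\<in>I. f i * g i) = 1" and "(\<Sum>i\<in>I. (g i)\<^sup>2) < 3"
  shows "\<exists>j\<in>I. (g j)\<^sup>2 = 1 \<and> f j = g j \<and> (\<forall>i\<in>I - {j}. g i = 0 \<and> even (f i))"
proof -
  have "odd (\<Sum>i\<in>I. (g i)\<^sup>2)" using even_sum_mult_iff[of I f g] par one by simp
  moreover have "(\<Sum>i\<in>I. (g i)\<^sup>2) \<ge> 0" by (simp add: sum_nonneg)
  ultimately have "(\<Sum>i\<in>I. (g i)\<^sup>2) = 1" using assms(4) by presburger
  then obtain j where j: "j \<in> I" "(g j)\<^sup>2 = 1" "\<And>i. i \<in> I - {j} \<Longrightarrow> g i = 0"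
    using sum_squares_eq_1E[OF assms(1)] by metis
  have "f j * g j = 1"
    using assms(1) one j(1,3) by (simp add: sum.remove)
  then have "f j = g j" by (auto simp: zmult_eq_1_iff)
  moreover have "even (f i)" if "i \<in> I - {j}" for i
    using par j(3)[of i] that by auto
  ultimately show ?thesis using j by blast
qed

lemma square_mod_8: "(x::int)\<^sup>2 mod 8 \<in> {0, 1, 4}"
proof -
  have "x mod 8 \<in> {0..<8}" by simp
  then have "x mod 8 \<in> set [0..7]" by auto
  then have "(x mod 8)\<^sup>2 mod 8 \<in> {0, 1, 4}" by (simp add: upto.simps) auto
  then show ?thesis by (simp add: power_mod)
qed

text \<open>No three of the residues 0, 1, 4 add up to 7 modulo 8.\<close>

lemma seven_not_sum_of_three_squares: "(x::int)\<^sup>2 + y\<^sup>2 + z\<^sup>2 \<noteq> 7"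
  using square_mod_8[of x] square_mod_8[of y] square_mod_8[of z] by auto presburger+

text \<open>The left side is a quadratic in \<open>a\<close> that is positive as soon as
  \<open>b\<close> is a nonzero integer, by completing the square. For \<open>b = 0\<close> it is
  nonpositive only on a short interval, whose even members are among the four listed values.\<close>

lemma quadratic_bound:
  fixes n a b :: int
  assumes "n \<ge> 17" and "even (a - b)"
    and le: "(n + 5) * a\<^sup>2 + 2 * (2 * n * b - 40) * a + (n\<^sup>2 + 5 * n) * b\<^sup>2 - 8 * n + 24 \<le> 0"
  shows "b = 0 \<and> a \<in> {-2, 0, 2, 4}"
proof -
  obtain m where m: "n = 17 + m" "m \<ge> 0"
    using assms(1) zle_iff_zadd by (metis add.commute of_nat_0_le_iff)
  have b: "b = 0"
  proof (rule ccontr)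
    assume "b \<noteq> 0"
    then have b1: "1 \<le> \<bar>b\<bar>" by simp
    then have b2: "1 \<le> b\<^sup>2" using power_mono[of 1 "\<bar>b\<bar>" 2] by simp
    have "\<bar>2 * n * b - 40\<bar> \<le> \<bar>2 * n * b\<bar> + 40" by linarith
    also have "\<dots> \<le> 2 * n * \<bar>b\<bar> + 40 * \<bar>b\<bar>" using b1 assms(1) by (simp add: abs_mult)
    finally have "\<bar>2 * n * b - 40\<bar> \<le> \<bar>(2 * n + 40) * \<bar>b\<bar>\<bar>"
      using assms(1) by (simp add: algebra_simps)
    then have "(2 * n * b - 40)\<^sup>2 \<le> ((2 * n + 40) * \<bar>b\<bar>)\<^sup>2" by (simp only: abs_le_square_iff)
    then have s: "(2 * n * b - 40)\<^sup>2 \<le> (2 * n + 40)\<^sup>2 * b\<^sup>2" by (simp add: power_mult_distrib)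
    \<comment> \<open>Once the square in \<open>a\<close> is completed, \<open>?c\<close> bounds the
      coefficient of b^2 from below, because the linear coefficient is at most (2n + 40)|b| in
      absolute value.\<close>
    let ?c = "n * (n + 5)\<^sup>2 - (2 * n + 40)\<^sup>2"
    \<comment> \<open>In terms of m = n - 17 all coefficients are positive, so the gap holds from n
      = 17 on, where it equals 288.\<close>
    have e: "?c - (8 * n - 24) * (n + 5) = m ^ 3 + 49 * m\<^sup>2 + 648 * m + 288"
      unfolding m(1) by (simp add: power2_eq_square power3_eq_cube algebra_simps)
    moreover have "0 \<le> m ^ 3" "0 \<le> m\<^sup>2" using m(2) by auto
    ultimately have c: "?c > (8 * n - 24) * (n + 5)" using m(2) by linarith
    moreover have "0 \<le> (8 * n - 24) * (n + 5)" using assms(1) by simp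
    ultimately have "?c * 1 \<le> ?c * b\<^sup>2" using b2 by (intro mult_left_mono) auto
    then have c': "(8 * n - 24) * (n + 5) < ?c * b\<^sup>2"
      using less_le_trans[OF c] by simp
    \<comment> \<open>Multiplying by n + 5 completes the square in \<open>a\<close> without
      fractions.\<close>
    have "((n + 5) * a + (2 * n * b - 40))\<^sup>2 + n * (n + 5)\<^sup>2 * b\<^sup>2 - (2 * n * b - 40)\<^sup>2
        - (8 * n - 24) * (n + 5)
      = (n + 5) * ((n + 5) * a\<^sup>2 + 2 * (2 * n * b - 40) * a + (n\<^sup>2 + 5 * n) * b\<^sup>2 - 8 * n + 24)"
      by (simp add: power2_eq_square algebra_simps)
    also have "\<dots> \<le> 0" using le assms(1) by (simp add: mult_le_0_iff)
    finally have "n * (n + 5)\<^sup>2 * b\<^sup>2 - (2 * n * b - 40)\<^sup>2 \<le> (8 * n - 24) * (n + 5)"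
      using zero_le_power2[of "(n + 5) * a + (2 * n * b - 40)"] by linarith
    moreover have "?c * b\<^sup>2 = n * (n + 5)\<^sup>2 * b\<^sup>2 - (2 * n + 40)\<^sup>2 * b\<^sup>2"
      by (simp add: algebra_simps)
    ultimately show False using s c' by linarith
  qed
  with assms(2) obtain k where k: "a = 2 * k" by auto
  \<comment> \<open>The hypothesis at \<open>b = 0\<close> and \<open>a = 2 * k\<close>, divided by
    4.\<close>
  have q: "(n + 5) * k\<^sup>2 - 40 * k + 6 \<le> 2 * n" using le unfolding b k by simp
  have "k \<le> 2"
  proof (rule ccontr)
    assume "\<not> k \<le> 2"
    then have k3: "3 \<le> k" by simp
    have "(n + 5) * k\<^sup>2 - 40 * k = k * ((n + 5) * k - 40)"
      by (simp add: power2_eq_square algebra_simps)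
    moreover have "(n + 5) * 3 \<le> (n + 5) * k" using k3 assms(1) by (intro mult_left_mono) auto
    then have "3 * ((n + 5) * 3 - 40) \<le> k * ((n + 5) * k - 40)"
      using k3 assms(1) by (intro mult_mono) auto
    ultimately show False using q assms(1) by simp
  qed
  moreover have "-1 \<le> k"
  proof (rule ccontr)
    assume "\<not> -1 \<le> k"
    then have k2: "2 \<le> -k" by simp
    then have "2\<^sup>2 \<le> (-k)\<^sup>2" by (intro power_mono) auto
    then have "(n + 5) * 4 \<le> (n + 5) * k\<^sup>2" using assms(1) by (intro mult_left_mono) auto
    then show False using q k2 assms(1) by simp
  qed
  ultimately have "k \<in> {-1, 0, 1, 2}" by auto
  then show ?thesis using b k by auto
qed

text \<open>With x_i = (p i + q i sqrt n)/2 and y_i = (a i + b i sqrt n)/2, the equations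
  \<open>yy\<close>, \<open>xx\<close>, \<open>xy\<close> are the rational and irrational parts of
  the coefficients of Y^2, X^2 and XY in a sum of six squares equal to phi, with denominators
  cleared.\<close>

lemma no_integer_solution:
  fixes n :: int and a b p q :: "'a \<Rightarrow> int"
  assumes n: "n \<ge> 17" and "card I = 6"
    and par: "\<And>i. i \<in> I \<Longrightarrow> even (a i - b i)" "\<And>i. i \<in> I \<Longrightarrow> even (p i - q i)"
    and yy: "(\<Sum>i\<in>I. (a i)\<^sup>2) + n * (\<Sum>i\<in>I. (b i)\<^sup>2) = n + 5" "(\<Sum>i\<in>I. a i * b i) = 1"
    and xx: "(\<Sum>i\<in>I. (p i)\<^sup>2) + n * (\<Sum>i\<in>I. (q i)\<^sup>2) = 6 * n + 154" "(\<Sum>i\<in>I. p i * q i) = 26"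
    and xy: "(\<Sum>i\<in>I. p i * a i) + n * (\<Sum>i\<in>I. q i * b i) = 2 * n + 20"
      "(\<Sum>i\<in>I. p i * b i) + (\<Sum>i\<in>I. q i * a i) = 14"
  shows False
proof -
  have fin: "finite I" using assms(2) by (metis card.infinite zero_neq_numeral)
  \<comment> \<open>Otherwise the rational part would be at least 3n, which exceeds n + 5.\<close>
  have "(\<Sum>i\<in>I. (b i)\<^sup>2) < 3"
  proof (rule ccontr)
    assume "\<not> ?thesis"
    then have "n * 3 \<le> n * (\<Sum>i\<in>I. (b i)\<^sup>2)" using n by (intro mult_left_mono) auto
    moreover have "(\<Sum>i\<in>I. (a i)\<^sup>2) \<ge> 0" by (simp add: sum_nonneg)
    ultimately show False using yy(1) n by linarith
  qed
  then obtain j where j: "j \<in> I" "(b j)\<^sup>2 = 1" "a j = b j"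
      "\<And>i. i \<in> I - {j} \<Longrightarrow> b i = 0" "\<And>i. i \<in> I - {j} \<Longrightarrow> even (a i)"
    using sum_mult_eq_1_imp[of I a b] fin par(1) yy(2) by blast
  \<comment> \<open>Now y_j is omega or -omega. The other y_i are the rational integers
    \<open>c i\<close>, and their squares add up to 1, so exactly one of them, y_k, is 1 or
    -1.\<close>
  define c where "c i = a i div 2" for i
  have c: "a i = 2 * c i" if "i \<in> I - {j}" for i using j(5)[OF that] by (simp add: c_def)
  have rem: "sum f I = f j + sum f (I - {j})" for f :: "'a \<Rightarrow> int"
    using fin j(1) by (simp add: sum.remove)
  have "(\<Sum>i\<in>I - {j}. (b i)\<^sup>2) = 0" using j(4) by (intro sum.neutral) simp
  then have "(\<Sum>i\<in>I - {j}. (a i)\<^sup>2) = 4"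
    using yy(1) j(2,3) by (simp add: rem)
  moreover have "(\<Sum>i\<in>I - {j}. (a i)\<^sup>2) = 4 * (\<Sum>i\<in>I - {j}. (c i)\<^sup>2)"
    unfolding sum_distrib_left by (intro sum.cong refl) (simp add: c power_mult_distrib)
  ultimately have "(\<Sum>i\<in>I - {j}. (c i)\<^sup>2) = 1" by simp
  then obtain k where k: "k \<in> I - {j}" "(c k)\<^sup>2 = 1" "\<And>i. i \<in> I - {j} - {k} \<Longrightarrow> c i = 0"
    using sum_squares_eq_1E[of "I - {j}" c] fin by (metis finite_Diff)
  \<comment> \<open>The four indices at which y vanishes; only the coefficient of X^2 sees the
    corresponding x_i.\<close>
  define T where "T = I - {j} - {k}"
  have split: "sum f I = f j + f k + sum f T" for f :: "'a \<Rightarrow> int"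
    using fin k(1) rem[of f] sum.remove[of "I - {j}" k f] by (simp add: T_def)
  have T0: "a i = 0" "b i = 0" if "i \<in> T" for i
    using that c[of i] k(3)[of i] j(4)[of i] by (auto simp: T_def)
  have "finite T" using fin by (simp add: T_def)
  have "card T = 4" using fin assms(2) j(1) k(1) by (simp add: T_def)
  have parT: "even (p i - q i)" if "i \<in> T" for i using that par(2) by (simp add: T_def)
  have bk: "b k = 0" "a k = 2 * c k" using j(4)[OF k(1)] c[OF k(1)] by simp_all
  \<comment> \<open>After normalising the signs, the coefficients of $X$ that go with $\omega$ and $1$ are
    $(P + Q\sqrt n)/2$ and $(R + S\sqrt n)/2$.\<close>
  define P Q R S where "P = b j * p j" and "Q = b j * q j" and "R = c k * p k" and "S = c k * q k"
  have e1: "P + 2 * R + n * Q = 2 * n + 20"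
    using xy(1) T0 by (simp add: split bk j(3) P_def Q_def R_def algebra_simps)
  have e2: "P + Q + 2 * S = 14"
    using xy(2) T0 by (simp add: split bk j(3) P_def Q_def S_def algebra_simps)
  have sq: "P\<^sup>2 = (p j)\<^sup>2" "Q\<^sup>2 = (q j)\<^sup>2" "R\<^sup>2 = (p k)\<^sup>2" "S\<^sup>2 = (q k)\<^sup>2"
    using j(2) k(2) by (simp_all add: P_def Q_def R_def S_def power_mult_distrib)
  have "P * Q = (b j)\<^sup>2 * (p j * q j)" "R * S = (c k)\<^sup>2 * (p k * q k)"
    by (simp_all add: P_def Q_def R_def S_def power2_eq_square)
  then have pr: "P * Q = p j * q j" "R * S = p k * q k" using j(2) k(2) by simp_all
  \<comment> \<open>The sum of the four remaining x_i^2 is (A + n B + 2 C sqrt n)/4.\<close>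
  define A B C where "A = (\<Sum>i\<in>T. (p i)\<^sup>2)" and "B = (\<Sum>i\<in>T. (q i)\<^sup>2)" and "C = (\<Sum>i\<in>T. p i * q i)"
  have AB: "A \<ge> 0" "B \<ge> 0" by (simp_all add: A_def B_def sum_nonneg)
  have t1: "A + n * B = 6 * n + 154 - P\<^sup>2 - R\<^sup>2 - n * Q\<^sup>2 - n * S\<^sup>2"
    using xx(1) by (simp add: split sq A_def B_def algebra_simps)
  have t2: "C = 26 - P * Q - R * S"
    using xx(2) by (simp add: split pr C_def)
  have evC: "even C \<longleftrightarrow> even B"
    unfolding B_def C_def using even_sum_mult_iff[OF parT] .
  \<comment> \<open>The cross term equations are solved by 6 + sqrt n - t and 2 + omega t with t =
    (u + v sqrt n)/2; \<open>u = v = 0\<close> is the solution with \<open>S = 0\<close>.\<close>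
  define u v where "u = 12 - P" and "v = 2 - Q"
  have P: "P = 12 - u" and Q: "Q = 2 - v" by (simp_all add: u_def v_def)
  have R: "2 * R = 8 + u + n * v" using e1 unfolding P Q by (simp add: algebra_simps)
  have S: "2 * S = u + v" using e2 unfolding P Q by simp
  have "even (u - v)" using S by presburger
  \<comment> \<open>The left side is \<open>-4 * (A + n * B)\<close>, so this is the nonnegativity
    of the trace of the four remaining squares.\<close>
  moreover have "(n + 5) * u\<^sup>2 + 2 * (2 * n * v - 40) * u + (n\<^sup>2 + 5 * n) * v\<^sup>2 - 8 * n + 24 \<le> 0"
  proof -
    have "0 \<le> A + n * B" using AB n by simp
    then have "4 * P\<^sup>2 + (2 * R)\<^sup>2 + n * (4 * Q\<^sup>2) + n * (2 * S)\<^sup>2 \<le> 24 * n + 616"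
      using t1 by (simp add: algebra_simps)
    then show ?thesis unfolding P Q R S by (simp add: power2_eq_square algebra_simps)
  qed
  ultimately have "v = 0" "u \<in> {-2, 0, 2, 4}" using quadratic_bound n by blast+
  then have u: "u = 0 \<or> u = 2 \<or> u = 4 \<or> u = -2" and v: "v = 0" by auto
  have C0: "C = 0" if "B = 0"
  proof -
    have "\<forall>i\<in>T. q i = 0"
      using that \<open>finite T\<close> by (simp add: B_def sum_nonneg_eq_0_iff)
    then show ?thesis by (simp add: C_def)
  qed
  have less: "B < m" if "A + n * B < n * m" for m
  proof -
    have "n * B < n * m" using that AB(1) by linarith
    then show ?thesis using n by simp
  qed
  from u consider "u = 0" | "u = 2" | "u = 4" | "u = -2" by blast
  then show False
  proof cases
    \<comment> \<open>In this case and for \<open>u = 4\<close>, \<open>C\<close> is even and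
      nonzero. Then \<open>B\<close> is even and below 2, hence 0, which would force
      \<open>C = 0\<close>.\<close>
    case 1
    then have "P = 12" "Q = 2" "R = 4" "S = 0" using P Q R S v by simp_all
    then have "A + n * B = 2 * n - 6" "C = 2" using t1 t2 by simp_all
    then have "B < 2" using less[of 2] by simp
    then have "B = 0" using AB(2) evC \<open>C = 2\<close> by presburger
    then show False using C0 \<open>C = 2\<close> by simp
  next
    \<comment> \<open>This is the decomposition displayed in phi, with omega^2 + 7 left over. Size
      and parity force one more omega or -omega among the four remaining x_i.\<close>
    case 2
    then have "P = 10" "Q = 2" "R = 5" "S = 1" using P Q R S v by simp_all
    then have *: "A + n * B = n + 29" and "C = 1" using t1 t2 by simp_all
    have "B < 3" using * less[of 3] n by simp
    then have B1: "B = 1" using evC AB(2) \<open>C = 1\<close> by presburger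
    obtain l where l: "l \<in> T" "(q l)\<^sup>2 = 1" "p l = q l" "\<And>i. i \<in> T - {l} \<Longrightarrow> even (p i)"
      using sum_mult_eq_1_imp[of T p q] \<open>finite T\<close> parT \<open>C = 1\<close> \<open>B < 3\<close>
      unfolding C_def B_def by blast
    \<comment> \<open>The other three \<open>p i\<close> are even and
      \<open>n + 29 - n - 1 = 28 = 4 * 7\<close>, so their halves would write 7 as a sum of three
      squares.\<close>
    have "(\<Sum>i\<in>T - {l}. (p i)\<^sup>2) = 28"
      using * \<open>C = 1\<close> l(1-3) B1 \<open>finite T\<close> by (simp add: A_def sum.remove)
    moreover have "(\<Sum>i\<in>T - {l}. (p i)\<^sup>2) = (\<Sum>i\<in>T - {l}. 4 * (p i div 2)\<^sup>2)"
    proof (intro sum.cong refl)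
      fix i assume "i \<in> T - {l}"
      then obtain m where "p i = 2 * m" using l(4) by blast
      then show "(p i)\<^sup>2 = 4 * (p i div 2)\<^sup>2" by (simp add: power_mult_distrib)
    qed
    ultimately have "(\<Sum>i\<in>T - {l}. (p i div 2)\<^sup>2) = 7"
      by (simp flip: sum_distrib_left)
    moreover have "card (T - {l}) = 3" using l(1) \<open>card T = 4\<close> by simp
    then obtain x y z where "T - {l} = {x, y, z}" "x \<noteq> y" "x \<noteq> z" "y \<noteq> z"
      by (auto simp: card_3_iff)
    ultimately have "(p x div 2)\<^sup>2 + (p y div 2)\<^sup>2 + (p z div 2)\<^sup>2 = 7" by simp
    then show False using seven_not_sum_of_three_squares by blast
  next
    case 3
    then have "P = 8" "Q = 2" "R = 6" "S = 2" using P Q R S v by simp_all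
    then have "A + n * B = 54 - 2 * n" "C = -2" using t1 t2 by simp_all
    then have "B < 2" using less[of 2] n by simp
    then have "B = 0" using AB(2) evC \<open>C = -2\<close> by presburger
    then show False using C0 \<open>C = -2\<close> by simp
  next
    \<comment> \<open>Here the trace bound alone gives \<open>B = 0\<close>, against
      \<open>C = 1\<close>.\<close>
    case 4
    then have "P = 14" "Q = 2" "R = 3" "S = -1" using P Q R S v by simp_all
    then have "A + n * B = n - 51" "C = 1" using t1 t2 by simp_all
    then have "B < 1" using less[of 1] by simp
    then have "B = 0" using AB(2) by simp
    then show False using C0 \<open>C = 1\<close> by simp
  qed
qed

subsection \<open>Integers of a real quadratic field\<close>

text \<open>Gauss's lemma: the primitive integer quadratic annihilating \<open>x\<close> divides a monic integer
  polynomial, hence is monic up to sign.\<close>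

lemma integer_quadratic_of_algebraic_int:
  fixes x :: "'a::field_char_0"
  assumes alg: "algebraic_int x" and "x \<notin> \<rat>"
    and g: "g \<noteq> 0" "degree g \<le> 2" "poly (map_poly of_int g) x = 0"
  obtains b c :: int where "x\<^sup>2 + of_int b * x + of_int c = 0"
proof -
  let ?ev = "\<lambda>p. poly (map_poly of_int p) x"
  \<comment> \<open>Irrationality of \<open>x\<close>: no nonzero integer polynomial of degree below
    2 annihilates it.\<close>
  have lin: "p = 0" if "degree p < 2" "?ev p = 0" for p
  proof (rule ccontr)
    assume "p \<noteq> 0"
    define u v where "u = coeff p 0" and "v = coeff p 1"
    have p: "p = [:u, v:]"
      using that(1) by (intro poly_eqI) (auto simp: u_def v_def coeff_pCons coeff_eq_0 split: nat.splits)
    then have ev: "of_int u + of_int v * x = 0"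
      using that(2) by (simp add: map_poly_pCons mult.commute)
    show False
    proof (cases "v = 0")
      case True
      then show False using ev p \<open>p \<noteq> 0\<close> by simp
    next
      case False
      then have "x = of_int (- u) / of_int v"
        using ev by (simp add: field_simps eq_neg_iff_add_eq_0)
      then show False using assms(2) by (metis Rats_divide Rats_of_int)
    qed
  qed
  define f where "f = primitive_part g"
  have f: "g = smult (content g) f" "content f = 1" "degree f = degree g"
    using g(1) by (simp_all add: f_def)
  have cg: "content g \<noteq> 0" using g(1) by simp
  have evs: "?ev (smult c h) = of_int c * ?ev h" for c h
    by (simp add: map_poly_smult)
  have eva: "?ev (h + h') = ?ev h + ?ev h'" for h h'
  proof -
    have "map_poly of_int (h + h') = map_poly of_int h + (map_poly of_int h' :: 'a poly)"
      by (intro poly_eqI) (simp add: coeff_map_poly)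
    then show ?thesis by simp
  qed
  have evm: "?ev (h * h') = ?ev h * ?ev h'" for h h'
    by (induction h) (simp_all add: eva evs map_poly_pCons algebra_simps)
  have evf: "?ev f = 0"
    using g(3) f(1) evs[of "content g" f] cg by simp
  have "f \<noteq> 0" using f(2) by auto
  have "degree f = 2"
    using lin[of f] evf g(2) f(3) \<open>f \<noteq> 0\<close> by (metis le_neq_implies_less)
  obtain p :: "int poly" where p: "?ev p = 0" "lead_coeff p = 1"
    using alg unfolding algebraic_int_altdef_ipoly by blast
  \<comment> \<open>Pseudo-division stays over the integers at the price of a factor
    \<open>a\<close> on \<open>p\<close>. The remainder has degree below 2 and annihilates
    \<open>x\<close>, so it vanishes by \<open>lin\<close>.\<close>
  define r where "r = pseudo_mod p f"
  obtain a q where a: "a \<noteq> 0" "smult a p = f * q + r" and r: "r = 0 \<or> degree r < degree f"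
    using pseudo_mod[OF \<open>f \<noteq> 0\<close>, of p] unfolding r_def by blast
  have "?ev (smult a p) = ?ev f * ?ev q + ?ev r" unfolding a(2) by (simp add: eva evm)
  then have "?ev r = 0" by (simp add: evs p(1) evf)
  then have "r = 0" using r lin[of r] \<open>degree f = 2\<close> by auto
  \<comment> \<open>Both \<open>p\<close> and \<open>f\<close> have content 1, so the content of
    \<open>q\<close> is the absolute value of \<open>a\<close>, and \<open>a\<close> cancels to
    leave an integral factorisation of the monic \<open>p\<close>.\<close>
  have "content p = 1"
    using content_dvd_coeff[of p "degree p"] p(2) by (metis is_unit_content_iff)
  then have "\<bar>a\<bar> = content q"
    using a(2) \<open>r = 0\<close> f(2) content_mult[of f q] content_smult[of a p] by simp
  then have "[:a:] dvd q"
    by (metis abs_dvd_iff const_poly_dvd_iff_dvd_content dvd_refl)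
  then obtain q' where "q = smult a q'" by (auto elim!: dvdE)
  then have "smult a p = smult a (f * q')" using a(2) \<open>r = 0\<close> by simp
  then have "smult a (p - f * q') = 0" by (simp add: smult_diff_right)
  then have "p = f * q'" using a(1) by simp
  then have "lead_coeff f * lead_coeff q' = 1"
    using p(2) by (simp add: lead_coeff_mult)
  then have u: "lead_coeff f = 1 \<or> lead_coeff f = -1" by (auto simp: zmult_eq_1_iff)
  define c0 c1 c2 where "c0 = coeff f 0" and "c1 = coeff f 1" and "c2 = coeff f 2"
  have fc: "f = [:c0, c1, c2:]"
    using \<open>degree f = 2\<close>
    by (intro poly_eqI) (auto simp: c0_def c1_def c2_def coeff_pCons coeff_eq_0 numeral_2_eq_2
        split: nat.splits)
  have e: "of_int c0 + of_int c1 * x + of_int c2 * x\<^sup>2 = 0"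
    using evf by (simp add: fc map_poly_pCons algebra_simps power2_eq_square)
  have "c2 = 1 \<or> c2 = -1"
    using u \<open>degree f = 2\<close> by (simp add: c2_def)
  then show ?thesis
  proof
    assume "c2 = 1"
    then have "x\<^sup>2 + of_int c1 * x + of_int c0 = 0" using e by (simp add: algebra_simps)
    then show ?thesis by (rule that)
  next
    assume "c2 = -1"
    then have "x\<^sup>2 + of_int (- c1) * x + of_int (- c0) = - (of_int c0 + of_int c1 * x + of_int c2 * x\<^sup>2)"
      by simp
    then have "x\<^sup>2 + of_int (- c1) * x + of_int (- c0) = 0" using e by simp
    then show ?thesis by (rule that)
  qed
qed

section \<open>Irrationality of sqrt n and the shape of the integers of Q(sqrt n)\<close>

lemma irrational_sqrt:
  fixes n :: int
  assumes "n > 1" "squarefree n"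
  shows "sqrt n \<notin> \<rat>"
proof
  assume "sqrt n \<in> \<rat>"
  then have "sqrt n \<in> \<int>" by (intro rational_algebraic_int_is_int algebraic_int_sqrt) auto
  then obtain m where "sqrt n = of_int m" by (elim Ints_cases)
  then have "real_of_int n = (of_int m)\<^sup>2"
    using assms(1) by (metis real_sqrt_pow2 of_int_0_le_iff less_imp_le less_trans zero_less_one)
  then have n: "n = m\<^sup>2" by (metis of_int_eq_iff of_int_power)
  then have "m dvd 1" using squarefreeD[OF assms(2)] by simp
  then have "n = 1" using n by (auto simp: power2_eq_1_iff)
  then show False using assms(1) by simp
qed

lemma sqrt_indep:
  assumes "s \<notin> \<rat>" "a \<in> \<rat>" "b \<in> \<rat>" "a + b * s = (0::real)"
  shows "a = 0 \<and> b = 0"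
proof -
  have "b = 0"
  proof (rule ccontr)
    assume "b \<noteq> 0"
    then have "s = - a / b" using assms(4) by (simp add: field_simps)
    then show False using assms(1-3) by (metis Rats_divide Rats_minus_iff)
  qed
  then show ?thesis using assms(4) by simp
qed

text \<open>The square of the reduced denominator of \<open>s\<close> must divide n, so the
  denominator is a unit.\<close>

lemma rational_int_of_squarefree_mult:
  fixes n k :: int and s :: real
  assumes "squarefree n" "s \<in> \<rat>" "of_int n * s\<^sup>2 = of_int k"
  shows "s \<in> \<int>"
proof -
  obtain u v where s: "s = of_int u / of_int v" "v > 0" "coprime u v"
    using assms(2) by (auto elim: Rats_cases')
  then have "real_of_int u = real_of_int v * s" by simp
  then have "real_of_int (n * u\<^sup>2) = real_of_int (k * v\<^sup>2)"
    using assms(3) by (simp add: power_mult_distrib mult.left_commute)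
  then have "n * u\<^sup>2 = k * v\<^sup>2" by (simp only: of_int_eq_iff)
  then have "v\<^sup>2 dvd n * u\<^sup>2" by simp
  moreover have "coprime (v\<^sup>2) (u\<^sup>2)" using s(3) by (simp add: coprime_commute)
  ultimately have "v\<^sup>2 dvd n" by (simp add: coprime_dvd_mult_left_iff)
  then have "v dvd 1" by (rule squarefreeD[OF assms(1)])
  then have "v = 1" using s(2) by simp
  then show ?thesis using s(1) by simp
qed

text \<open>The classical ring Z[omega], written with half-integers so that membership becomes the
  parity condition used in the integer system.\<close>

lemma ring_of_integers_real_quadratic:
  fixes n :: int
  assumes "n > 1" "squarefree n" "[n = 1] (mod 4)"
  shows "ring_of_integers (real_quadratic_field n)
    = {(p + q * sqrt n) / 2 | p q :: int. even (p - q)}" (is "?O = ?Z")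
proof (intro equalityI subsetI)
  have irr: "sqrt n \<notin> \<rat>" by (rule irrational_sqrt) fact+
  have sq: "(sqrt n)\<^sup>2 = n" using assms(1) by simp
  have F: "real_quadratic_field n = {a + b * sqrt n | a b. a \<in> \<rat> \<and> b \<in> \<rat>}"
    using assms(1) by (intro real_quadratic_field_eq) simp
  have n1: "4 dvd n - 1" using assms(3) by (simp add: cong_iff_dvd_diff)
  {
    fix x assume "x \<in> ?O"
    then obtain r s where x: "x = r + s * sqrt n" "r \<in> \<rat>" "s \<in> \<rat>" and alg: "algebraic_int x"
      unfolding ring_of_integers_def F by blast
    show "x \<in> ?Z"
    proof (cases "s = 0")
      case True
      then have "x \<in> \<int>" using x alg rational_algebraic_int_is_int by auto
      then obtain m where "x = of_int m" by (elim Ints_cases)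
      then have "x = (real_of_int (2 * m) + real_of_int 0 * sqrt n) / 2" by simp
      moreover have "even (2 * m - 0)" by simp
      ultimately show ?thesis by blast
    next
      case False
      have "x \<notin> \<rat>"
      proof
        assume "x \<in> \<rat>"
        then have "r - x \<in> \<rat>" using x(2) by simp
        moreover have "(r - x) + s * sqrt n = 0" using x(1) by simp
        ultimately show False using sqrt_indep[OF irr _ x(3)] False by blast
      qed
      obtain A D where r: "r = of_int A / of_int D" "D > 0" using x(2) by (auto elim: Rats_cases')
      obtain B E where s: "s = of_int B / of_int E" "E > 0" using x(3) by (auto elim: Rats_cases')
      \<comment> \<open>Clearing denominators in (x - r)^2 = n s^2 gives an integer quadratic
        annihilating \<open>x\<close>.\<close>
      define g where "g = [:(A * E)\<^sup>2 - n * (B * D)\<^sup>2, - 2 * (A * E) * (D * E), (D * E)\<^sup>2:]"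
      have DE: "of_int (D * E) * x - of_int (A * E) = of_int (B * D) * sqrt n"
      proof -
        have "of_int A = of_int D * r" "of_int B = of_int E * s" using r s by simp_all
        then show ?thesis by (simp add: x(1) algebra_simps)
      qed
      have "(of_int (D * E) * x - of_int (A * E))\<^sup>2 = (of_int (B * D))\<^sup>2 * real_of_int n"
        unfolding DE power_mult_distrib sq ..
      then have "poly (map_poly of_int g) x = 0"
        by (simp add: g_def map_poly_pCons algebra_simps power2_eq_square)
      moreover have "g \<noteq> 0" "degree g \<le> 2" using r(2) s(2) by (simp_all add: g_def)
      ultimately obtain b c :: int where bc: "x\<^sup>2 + of_int b * x + of_int c = 0"
        using integer_quadratic_of_algebraic_int[OF alg \<open>x \<notin> \<rat>\<close>] by blast
      have "x\<^sup>2 = r\<^sup>2 + s\<^sup>2 * (sqrt n)\<^sup>2 + 2 * r * s * sqrt n"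
        unfolding x(1) by (simp add: power2_eq_square algebra_simps)
      then have "(r\<^sup>2 + s\<^sup>2 * n + b * r + c) + (2 * r * s + b * s) * sqrt n = 0"
        using bc unfolding sq by (simp add: x(1) algebra_simps)
      then have e: "r\<^sup>2 + s\<^sup>2 * n + b * r + c = 0" "(2 * r + b) * s = 0"
        using sqrt_indep[OF irr, of "r\<^sup>2 + s\<^sup>2 * n + b * r + c" "2 * r * s + b * s"] x(2,3)
        by (simp_all add: algebra_simps)
      then have b: "b = - 2 * r" using False by simp
      \<comment> \<open>The discriminant identity: it bounds the denominator of \<open>s\<close> by
        2.\<close>
      have ns: "of_int n * (2 * s)\<^sup>2 = of_int (b\<^sup>2 - 4 * c)"
        using e(1) by (simp add: b power2_eq_square algebra_simps)
      then have "2 * s \<in> \<int>"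
        using rational_int_of_squarefree_mult[OF assms(2) _ ns] x(3) by simp
      then obtain q where q: "2 * s = of_int q" by (elim Ints_cases)
      have "n * q\<^sup>2 = b\<^sup>2 - 4 * c" using ns unfolding q by (metis of_int_eq_iff of_int_mult of_int_power)
      moreover obtain k where "n = 1 + 4 * k" using n1 by (metis dvdE add.commute diff_add_cancel)
      \<comment> \<open>Here n = 1 modulo 4 enters: b^2 - q^2 = (n - 1) q^2 + 4 c is even, so
        \<open>b\<close> and \<open>q\<close> have the same parity.\<close>
      ultimately have "b\<^sup>2 - q\<^sup>2 = 2 * (2 * (k * q\<^sup>2) + 2 * c)" by (simp add: algebra_simps)
      then have "even (b\<^sup>2 - q\<^sup>2)" by (metis dvd_triv_left)
      then have "even (- b - q)" by simp
      moreover have "x = (of_int (- b) + of_int q * sqrt n) / 2"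
        using b q by (simp add: x(1) field_simps)
      ultimately show ?thesis by blast
    qed
  next
    fix x assume "x \<in> ?Z"
    then obtain p q :: int where x: "x = (p + q * sqrt n) / 2" "even (p - q)" by blast
    obtain k where k: "n = 1 + 4 * k" using n1 by (metis dvdE add.commute diff_add_cancel)
    obtain m where m: "p = q + 2 * m" using x(2) by (metis dvdE add.commute diff_add_cancel)
    \<comment> \<open>\<open>c\<close> is the norm of \<open>x\<close> and \<open>p\<close> its
      trace, so \<open>x\<close> is a root of the monic polynomial T^2 - p T + c.\<close>
    define c where "c = m * q + m\<^sup>2 - k * q\<^sup>2"
    have c: "4 * c = p\<^sup>2 - n * q\<^sup>2"
      unfolding c_def k m by (simp add: power2_eq_square algebra_simps)
    have "2 * x - p = q * sqrt n" by (simp add: x(1) field_simps)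
    then have "(2 * x - p)\<^sup>2 = (real_of_int q)\<^sup>2 * n" by (simp add: power_mult_distrib sq)
    then have "4 * (x\<^sup>2 - p * x + c) = real_of_int (4 * c - (p\<^sup>2 - n * q\<^sup>2))"
      by (simp add: power2_eq_square algebra_simps)
    then have "x\<^sup>2 - p * x + c = 0" using c by simp
    then have "poly [:real_of_int c, - of_int p, 1:] x = 0"
      by (simp add: power2_eq_square algebra_simps)
    then have "algebraic_int x"
      by (rule algebraic_int.intros[rotated 2]) (auto simp: coeff_pCons split: nat.splits)
    moreover have "x = of_int p / 2 + (of_int q / 2) * sqrt n" by (simp add: x(1) add_divide_distrib)
    moreover have "real_of_int p / 2 \<in> \<rat>" "real_of_int q / 2 \<in> \<rat>" by simp_all
    ultimately show "x \<in> ?O"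
      unfolding ring_of_integers_def F by blast
  }
qed

subsection \<open>Binary quadratic forms as sums of squares\<close>

definition binary_quadratic :: "'a::comm_ring_1 \<Rightarrow> 'a \<Rightarrow> 'a \<Rightarrow> 'a mpolynomial" where
  "binary_quadratic A B C = Const A * (Var 1)\<^sup>2 + Const B * (Var 1 * Var 2) + Const C * (Var 2)\<^sup>2"

lemma Const_add: "Const (a + b) = Const a + Const b"
  and Const_mult: "Const (a * b) = Const a * Const b"
  and Const_0: "Const 0 = 0"
  and Const_1: "Const 1 = 1"
  by (simp_all add: Const_def single_add mult_single)

text \<open>Multiplication adds exponent vectors, so \<open>v i + v j\<close> is the monomial X_i
  X_j.\<close>

lemma quadratic_monomials_distinct:
  defines "v \<equiv> \<lambda>i. Poly_Mapping.single (i::nat) (1::nat)"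
  shows "v 1 + v 1 \<noteq> v 1 + v 2" "v 1 + v 1 \<noteq> v 2 + v 2" "v 1 + v 2 \<noteq> v 2 + v 2"
proof -
  have "Poly_Mapping.lookup (v 1 + v 1) 1 = 2" "Poly_Mapping.lookup (v 1 + v 2) 1 = 1"
    "Poly_Mapping.lookup (v 2 + v 2) 1 = 0"
    by (simp_all add: v_def lookup_add lookup_single)
  then show "v 1 + v 1 \<noteq> v 1 + v 2" "v 1 + v 1 \<noteq> v 2 + v 2" "v 1 + v 2 \<noteq> v 2 + v 2"
    by (metis one_eq_numeral_iff numeral_One zero_neq_numeral zero_neq_one semiring_norm(85))+
qed

lemma lookup_binary_quadratic:
  fixes A B C :: "'a::comm_ring_1"
  defines "v \<equiv> \<lambda>i. Poly_Mapping.single (i::nat) (1::nat)"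
  shows "Poly_Mapping.lookup (binary_quadratic A B C) m =
    (if m = v 1 + v 1 then A else if m = v 1 + v 2 then B else if m = v 2 + v 2 then C else 0)"
proof -
  have d: "v 1 + v 1 \<noteq> v 1 + v 2" "v 1 + v 1 \<noteq> v 2 + v 2" "v 1 + v 2 \<noteq> v 2 + v 2"
    unfolding v_def by (rule quadratic_monomials_distinct)+
  have "binary_quadratic A B C = Poly_Mapping.single (v 1 + v 1) A + Poly_Mapping.single (v 1 + v 2) B
      + Poly_Mapping.single (v 2 + v 2) C"
    by (simp add: binary_quadratic_def Const_def Var_def power2_eq_square mult_single v_def)
  moreover have "Poly_Mapping.lookup (Poly_Mapping.single x A + Poly_Mapping.single y B
      + Poly_Mapping.single z C) m = (if m = x then A else if m = y then B else if m = z then C else 0)"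
    if "x \<noteq> y" "x \<noteq> z" "y \<noteq> z" for x y z
    using that by (auto simp: lookup_add lookup_single when_def)
  ultimately show ?thesis using d by presburger
qed

lemma binary_quadratic_inject:
  "binary_quadratic A B C = binary_quadratic A' B' C' \<longleftrightarrow> A = A' \<and> B = B' \<and> C = C'"
proof
  define v where "v i = Poly_Mapping.single (i::nat) (1::nat)" for i
  assume "binary_quadratic A B C = binary_quadratic A' B' C'"
  then have e: "Poly_Mapping.lookup (binary_quadratic A B C) m =
      Poly_Mapping.lookup (binary_quadratic A' B' C') m" for m by simp
  note d = quadratic_monomials_distinct[folded v_def]
  show "A = A' \<and> B = B' \<and> C = C'"
    using e[of "v 1 + v 1"] e[of "v 1 + v 2"] e[of "v 2 + v 2"] d d[symmetric]
    unfolding lookup_binary_quadratic v_def[symmetric] by simp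
qed simp

lemma binary_quadratic_in_forms:
  assumes "0 \<in> R" "A \<in> R" "B \<in> R" "C \<in> R"
  shows "binary_quadratic A B C \<in> forms R 2 2"
proof -
  define v where "v i = Poly_Mapping.single (i::nat) (1::nat)" for i
  have "Poly_Mapping.lookup (binary_quadratic A B C) m \<in> R" for m
    using assms by (simp add: lookup_binary_quadratic)
  moreover have "Poly_Mapping.keys m \<subseteq> {1..2} \<and> total_degree m = 2"
    if m: "m \<in> Poly_Mapping.keys (binary_quadratic A B C)" for m
  proof -
    have "m = v 1 + v 1 \<or> m = v 1 + v 2 \<or> m = v 2 + v 2"
      using m unfolding in_keys_iff lookup_binary_quadratic v_def by presburger
    moreover have "v i + v j = Poly_Mapping.single i 2" if "i = j" for i j
      unfolding v_def that by (simp add: numeral_2_eq_2 flip: single_add)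
    moreover have "Poly_Mapping.keys (v 1 + v 2) = {1, 2}"
      by (auto simp: v_def in_keys_iff lookup_add lookup_single when_def split: if_splits)
    moreover from this have "total_degree (v 1 + v 2) = 2"
      by (simp add: total_degree_def v_def lookup_add lookup_single)
    ultimately show ?thesis by (auto simp: total_degree_def)
  qed
  ultimately show ?thesis by (simp add: forms_def)
qed

lemma binary_quadratic_add:
  "binary_quadratic A B C + binary_quadratic A' B' C' = binary_quadratic (A + A') (B + B') (C + C')"
  by (simp add: binary_quadratic_def Const_add algebra_simps)

lemma linear_form_square:
  "(Const a * Var 1 + Const b * Var 2)\<^sup>2 = binary_quadratic (a\<^sup>2) (2 * a * b) (b\<^sup>2)"
proof -
  have "Const (2 * a * b) = Const a * Const b + Const a * Const b"
    by (simp add: mult.assoc flip: Const_mult Const_add)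
  then show ?thesis
    by (simp add: binary_quadratic_def Const_mult power2_eq_square algebra_simps)
qed

lemma sum_linear_form_squares:
  "(\<Sum>i\<in>I. (Const (x i) * Var 1 + Const (y i) * Var 2)\<^sup>2)
    = binary_quadratic (\<Sum>i\<in>I. (x i)\<^sup>2) (2 * (\<Sum>i\<in>I. x i * y i)) (\<Sum>i\<in>I. (y i)\<^sup>2)"
proof -
  have C: "Const (\<Sum>i\<in>I. h i) = (\<Sum>i\<in>I. Const (h i))" for h :: "'b \<Rightarrow> 'a"
    by (induction I rule: infinite_finite_induct) (simp_all add: Const_0 Const_add)
  show ?thesis
    unfolding linear_form_square binary_quadratic_def
    by (simp add: C sum.distrib sum_distrib_left sum_distrib_right mult.assoc)
qed

text \<open>Comparing coefficients replaces the polynomial identity by three equations in the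
  ring.\<close>

lemma sum_of_squares_binary_iff:
  assumes "0 \<in> R"
  shows "sum_of_squares_of_linear_forms R 2 k (binary_quadratic A B C) \<longleftrightarrow>
    (\<exists>x y. (\<forall>i<k. x i \<in> R \<and> y i \<in> R) \<and> A = (\<Sum>i<k. (x i)\<^sup>2) \<and>
       B = 2 * (\<Sum>i<k. x i * y i) \<and> C = (\<Sum>i<k. (y i)\<^sup>2))" (is "?L \<longleftrightarrow> ?R")
proof
  assume ?L
  then obtain l where l: "\<And>i. i < k \<Longrightarrow> l i \<in> forms R 2 1"
    and e: "binary_quadratic A B C = (\<Sum>i<k. (l i)\<^sup>2)"
    unfolding sum_of_squares_of_linear_forms_def by blast
  have "\<forall>i. \<exists>a b. i < k \<longrightarrow> l i = Const a * Var 1 + Const b * Var 2 \<and> a \<in> R \<and> b \<in> R"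
    using l unfolding forms_2_1_eq[OF assms] by blast
  then obtain x y where xy:
    "\<And>i. i < k \<Longrightarrow> l i = Const (x i) * Var 1 + Const (y i) * Var 2 \<and> x i \<in> R \<and> y i \<in> R"
    by metis
  have "binary_quadratic A B C = (\<Sum>i<k. (Const (x i) * Var 1 + Const (y i) * Var 2)\<^sup>2)"
    unfolding e using xy by (intro sum.cong) auto
  then show ?R
    unfolding sum_linear_form_squares binary_quadratic_inject using xy by blast
next
  assume ?R
  then obtain x y where xy: "\<forall>i<k. x i \<in> R \<and> y i \<in> R" and
    e: "A = (\<Sum>i<k. (x i)\<^sup>2)" "B = 2 * (\<Sum>i<k. x i * y i)" "C = (\<Sum>i<k. (y i)\<^sup>2)"
    by blast
  have "binary_quadratic A B C = (\<Sum>i<k. (Const (x i) * Var 1 + Const (y i) * Var 2)\<^sup>2)"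
    unfolding e sum_linear_form_squares ..
  moreover have "\<forall>i<k. Const (x i) * Var 1 + Const (y i) * Var 2 \<in> forms R 2 1"
    using xy unfolding forms_2_1_eq[OF assms] by blast
  ultimately show ?L
    unfolding sum_of_squares_of_linear_forms_def
    by (intro exI[of _ "\<lambda>i. Const (x i) * Var 1 + Const (y i) * Var 2"] conjI)
qed

section \<open>Lower bounds for the g-invariant\<close>

lemma sum_of_squares_mono:
  assumes "0 \<in> R" "j \<le> k" "sum_of_squares_of_linear_forms R r j p"
  shows "sum_of_squares_of_linear_forms R r k p"
proof -
  obtain l where l: "\<forall>i<j. l i \<in> forms R r 1" "p = (\<Sum>i<j. (l i)\<^sup>2)"
    using assms(3) unfolding sum_of_squares_of_linear_forms_def by blast
  define l' where "l' i = (if i < j then l i else 0)" for i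
  have "0 \<in> forms R r 1" using assms(1) by (simp add: forms_def)
  then have "\<forall>i<k. l' i \<in> forms R r 1" using l(1) by (simp add: l'_def)
  moreover have "(\<Sum>i<k. (l' i)\<^sup>2) = (\<Sum>i<j. (l i)\<^sup>2)"
    using assms(2) by (intro sum.mono_neutral_cong_right) (auto simp: l'_def)
  ultimately show ?thesis
    using l(2) unfolding sum_of_squares_of_linear_forms_def by metis
qed

text \<open>Padding with zero forms shows that failure at \<open>k\<close> is failure at every
  smaller count. The infimum argument also covers the case where no count is admissible.\<close>

lemma g_invariant_ge:
  assumes "0 \<in> R" "p \<in> Sigma_forms R r" "\<not> sum_of_squares_of_linear_forms R r k p"
  shows "g_invariant R r \<ge> enat (Suc k)"
  unfolding g_invariant_def
proof (rule INF_greatest)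
  fix j assume "j \<in> {k. \<forall>p\<in>Sigma_forms R r. sum_of_squares_of_linear_forms R r k p}"
  then have "sum_of_squares_of_linear_forms R r j p" using assms(2) by blast
  then have "\<not> j \<le> k" using sum_of_squares_mono[OF assms(1)] assms(3) by blast
  then show "enat (Suc k) \<le> enat j" by simp
qed

subsection \<open>The form $\phi$\<close>

lemma \<phi>_eq_binary_quadratic:
  assumes "n \<ge> 0"
  shows "\<phi> n = binary_quadratic ((3 * n + 77 + 26 * sqrt n) / 2) (10 + n + 7 * sqrt n)
    ((n + 5 + 2 * sqrt n) / 4)"
proof -
  define s where "s = sqrt n"
  define a b c :: real where "a = 7 + ((1 + s) / 2)\<^sup>2" and "b = (5 + s) / 2" and "c = (1 + s) / 2"
  have s: "s * s = n" using assms by (simp add: s_def)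
  have "\<phi> n = Const a * (Var 1)\<^sup>2 + (Const b * Var 1 + Const 1 * Var 2)\<^sup>2
      + (Const (2 * b) * Var 1 + Const c * Var 2)\<^sup>2"
  proof -
    have b2: "2 * b = 5 + s" by (simp add: b_def)
    show ?thesis
      unfolding b2 unfolding \<phi>_def Let_def s_def[symmetric] a_def b_def c_def by (simp add: Const_1)
  qed
  also have "\<dots> = binary_quadratic (a + b\<^sup>2 + (2 * b)\<^sup>2) (2 * b + 2 * (2 * b) * c) (1 + c\<^sup>2)"
  proof -
    \<comment> \<open>The term 7 + omega^2 is not presented as one square, so it enters as a form
      with two zero coefficients.\<close>
    have "Const a * (Var 1)\<^sup>2 = binary_quadratic a 0 0"
      by (simp add: binary_quadratic_def Const_0)
    then show ?thesis unfolding linear_form_square by (simp add: binary_quadratic_add)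
  qed
  also have "a + b\<^sup>2 + (2 * b)\<^sup>2 = (3 * n + 77 + 26 * s) / 2"
    by (simp add: a_def b_def power2_eq_square field_simps s)
  also have "2 * b + 2 * (2 * b) * c = 10 + n + 7 * s"
    by (simp add: b_def c_def power2_eq_square field_simps s)
  also have "1 + c\<^sup>2 = (n + 5 + 2 * s) / 4"
    by (simp add: c_def power2_eq_square field_simps s)
  finally show ?thesis by (simp add: s_def)
qed

section \<open>From real coefficients to integer equations\<close>

lemma int_sqrt_eq_iff:
  fixes n u v u' v' :: int
  assumes "sqrt n \<notin> \<rat>"
  shows "real_of_int u + of_int v * sqrt n = of_int u' + of_int v' * sqrt n \<longleftrightarrow> u = u' \<and> v = v'"
proof
  assume "real_of_int u + of_int v * sqrt n = of_int u' + of_int v' * sqrt n"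
  then have "of_int (u - u') + of_int (v - v') * sqrt n = 0" by (simp add: algebra_simps)
  then have "real_of_int (u - u') = 0 \<and> real_of_int (v - v') = 0"
    using sqrt_indep[OF assms, of "of_int (u - u')" "of_int (v - v')"] by simp
  then show "u = u' \<and> v = v'" by simp
qed simp

text \<open>Stated for products rather than squares, so that one formula serves the coefficients of
  X^2, XY and Y^2.\<close>

lemma sum_mult_quadratic_integers:
  fixes n :: int and p q a b :: "'a \<Rightarrow> int"
  assumes "n \<ge> 0"
  shows "(\<Sum>i\<in>I. (p i + q i * sqrt n) / 2 * ((a i + b i * sqrt n) / 2))
    = (of_int ((\<Sum>i\<in>I. p i * a i) + n * (\<Sum>i\<in>I. q i * b i))
        + of_int ((\<Sum>i\<in>I. p i * b i) + (\<Sum>i\<in>I. q i * a i)) * sqrt n) / 4"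
proof -
  have s: "sqrt n * sqrt n = n" using assms by simp
  have "(p i + q i * sqrt n) / 2 * ((a i + b i * sqrt n) / 2)
      = (of_int (p i * a i + n * (q i * b i)) + of_int (p i * b i + q i * a i) * sqrt n) / 4" for i
    using s by (simp add: algebra_simps add_divide_distrib)
  then show ?thesis
    by (simp add: sum.distrib sum_distrib_left sum_distrib_right sum_divide_distrib add_divide_distrib
        distrib_right del: of_int_mult)
qed

theorem proposition5p3:
  fixes n :: int
  assumes "n \<ge> 17" and "squarefree n" and "[n = 1] (mod 4)"
  shows "let O\<^sub>F = ring_of_integers (real_quadratic_field n) in
    g_invariant O\<^sub>F 2 \<ge> 7 \<and>
    \<phi> n = Const ((3 * n + 77 + 26 * sqrt n) / 2) * (Var 1)\<^sup>2
          + Const (10 + n + 7 * sqrt n) * (Var 1 * Var 2)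
          + Const ((n + 5 + 2 * sqrt n) / 4) * (Var 2)\<^sup>2 \<and>
    sum_of_squares_of_linear_forms O\<^sub>F 2 7 (\<phi> n) \<and>
    \<not> sum_of_squares_of_linear_forms O\<^sub>F 2 6 (\<phi> n)"
proof -
  define O\<^sub>F where "O\<^sub>F = ring_of_integers (real_quadratic_field n)"
  define s where "s = sqrt n"
  define \<omega> where "\<omega> = (1 + s) / 2"
  have n: "n > 1" "n \<ge> 0" using assms(1) by simp_all
  have s2: "s * s = n" using n by (simp add: s_def)
  have irr: "sqrt n \<notin> \<rat>" using irrational_sqrt n(1) assms(2) .
  have O: "O\<^sub>F = {(p + q * sqrt n) / 2 | p q :: int. even (p - q)}"
    unfolding O\<^sub>F_def using ring_of_integers_real_quadratic n(1) assms(2,3) .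
  have OI: "(of_int p + of_int q * s) / 2 \<in> O\<^sub>F" if "even (p - q)" for p q :: int
    using that unfolding O s_def by blast
  have mem: "0 \<in> O\<^sub>F" "1 \<in> O\<^sub>F" "2 \<in> O\<^sub>F" "\<omega> \<in> O\<^sub>F" "(5 + s) / 2 \<in> O\<^sub>F" "5 + s \<in> O\<^sub>F"
    using OI[of 0 0] OI[of 2 0] OI[of 4 0] OI[of 1 1] OI[of 5 1] OI[of 10 2]
    by (simp_all add: \<omega>_def add_divide_distrib)
  let ?A = "(3 * n + 77 + 26 * s) / 2" and ?B = "10 + n + 7 * s" and ?C = "(n + 5 + 2 * s) / 4"
  have \<phi>: "\<phi> n = binary_quadratic ?A ?B ?C"
    using \<phi>_eq_binary_quadratic[OF n(2)] by (simp add: s_def)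
  have seven: "sum_of_squares_of_linear_forms O\<^sub>F 2 7 (\<phi> n)"
    unfolding \<phi> sum_of_squares_binary_iff[OF mem(1)]
  proof (intro exI conjI allI impI)
    \<comment> \<open>The first four forms 2X, X, X, X make up 7X^2; then come omega X and the two
      squares displayed in phi.\<close>
    let ?x = "\<lambda>i. [2, 1, 1, 1, \<omega>, (5 + s) / 2, 5 + s] ! i"
    let ?y = "\<lambda>i. [0, 0, 0, 0, 0, 1, \<omega>] ! i"
    fix i :: nat assume "i < 7"
    then have "i \<in> {0, 1, 2, 3, 4, 5, 6}" by auto
    then show "?x i \<in> O\<^sub>F" "?y i \<in> O\<^sub>F" using mem by auto
  next
    show "?A = (\<Sum>i<7. ([2, 1, 1, 1, \<omega>, (5 + s) / 2, 5 + s] ! i)\<^sup>2)"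
      using s2 by (simp add: eval_nat_numeral \<omega>_def field_simps)
    show "?B = 2 * (\<Sum>i<7. [2, 1, 1, 1, \<omega>, (5 + s) / 2, 5 + s] ! i * [0, 0, 0, 0, 0, 1, \<omega>] ! i)"
      using s2 by (simp add: eval_nat_numeral \<omega>_def field_simps)
    show "?C = (\<Sum>i<7. ([0, 0, 0, 0, 0, 1, \<omega>] ! i)\<^sup>2)"
      using s2 by (simp add: eval_nat_numeral \<omega>_def field_simps)
  qed
  have six: "\<not> sum_of_squares_of_linear_forms O\<^sub>F 2 6 (\<phi> n)"
  proof
    assume "sum_of_squares_of_linear_forms O\<^sub>F 2 6 (\<phi> n)"
    then obtain x y where xy: "\<And>i::nat. i < 6 \<Longrightarrow> x i \<in> O\<^sub>F" "\<And>i::nat. i < 6 \<Longrightarrow> y i \<in> O\<^sub>F"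
      and e: "?A = (\<Sum>i<6. x i * x i)" "?B = 2 * (\<Sum>i<6. x i * y i)" "?C = (\<Sum>i<6. y i * y i)"
      unfolding \<phi> sum_of_squares_binary_iff[OF mem(1)] power2_eq_square by blast
    have "\<forall>i. \<exists>p q. i < 6 \<longrightarrow> x i = (of_int p + of_int q * sqrt n) / 2 \<and> even (p - q)"
      using xy(1) unfolding O by blast
    then obtain p q where x: "\<And>i. i < 6 \<Longrightarrow> x i = (of_int (p i) + of_int (q i) * sqrt n) / 2"
      and pq: "\<And>i. i < 6 \<Longrightarrow> even (p i - q i)" by metis
    have "\<forall>i. \<exists>a b. i < 6 \<longrightarrow> y i = (of_int a + of_int b * sqrt n) / 2 \<and> even (a - b)"
      using xy(2) unfolding O by blast
    then obtain a b where y: "\<And>i. i < 6 \<Longrightarrow> y i = (of_int (a i) + of_int (b i) * sqrt n) / 2"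
      and ab: "\<And>i. i < 6 \<Longrightarrow> even (a i - b i)" by metis
    have "(\<Sum>i<6. x i * x i) = (\<Sum>i<6. (of_int (p i) + of_int (q i) * sqrt n) / 2
        * ((of_int (p i) + of_int (q i) * sqrt n) / 2))"
      "(\<Sum>i<6. x i * y i) = (\<Sum>i<6. (of_int (p i) + of_int (q i) * sqrt n) / 2
        * ((of_int (a i) + of_int (b i) * sqrt n) / 2))"
      "(\<Sum>i<6. y i * y i) = (\<Sum>i<6. (of_int (a i) + of_int (b i) * sqrt n) / 2
        * ((of_int (a i) + of_int (b i) * sqrt n) / 2))"
      by (intro sum.cong refl; simp add: x y)+
    note sums = this[unfolded sum_mult_quadratic_integers[OF n(2)]]
    \<comment> \<open>Clearing denominators multiplies \<open>?A\<close> and \<open>?C\<close> by 4,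
      but \<open>?B\<close> only by 2, since it is already twice a sum.\<close>
    have A: "of_int (6 * n + 154) + of_int 52 * sqrt n
        = of_int ((\<Sum>i<6. p i * p i) + n * (\<Sum>i<6. q i * q i))
          + of_int ((\<Sum>i<6. p i * q i) + (\<Sum>i<6. q i * p i)) * sqrt n"
      using e(1) unfolding sums s_def by simp
    have B: "of_int (2 * n + 20) + of_int 14 * sqrt n
        = of_int ((\<Sum>i<6. p i * a i) + n * (\<Sum>i<6. q i * b i))
          + of_int ((\<Sum>i<6. p i * b i) + (\<Sum>i<6. q i * a i)) * sqrt n"
      using e(2) unfolding sums s_def by simp
    have C: "of_int (n + 5) + of_int 2 * sqrt n
        = of_int ((\<Sum>i<6. a i * a i) + n * (\<Sum>i<6. b i * b i))
          + of_int ((\<Sum>i<6. a i * b i) + (\<Sum>i<6. b i * a i)) * sqrt n"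
      using e(3) unfolding sums s_def by simp
    \<comment> \<open>The two cross sums agree, which halves the irrational parts 52 and 2 to 26 and
      1.\<close>
    have comm: "(\<Sum>i<6. q i * p i) = (\<Sum>i<6. p i * q i)" "(\<Sum>i<6. b i * a i) = (\<Sum>i<6. a i * b i)"
      by (simp_all add: mult.commute)
    have xx: "(\<Sum>i<6. p i * p i) + n * (\<Sum>i<6. q i * q i) = 6 * n + 154"
        "(\<Sum>i<6. p i * q i) = 26"
      using A unfolding int_sqrt_eq_iff[OF irr] comm by simp_all
    have xy: "(\<Sum>i<6. p i * a i) + n * (\<Sum>i<6. q i * b i) = 2 * n + 20"
        "(\<Sum>i<6. p i * b i) + (\<Sum>i<6. q i * a i) = 14"
      using B unfolding int_sqrt_eq_iff[OF irr] by simp_all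
    have yy: "(\<Sum>i<6. a i * a i) + n * (\<Sum>i<6. b i * b i) = n + 5" "(\<Sum>i<6. a i * b i) = 1"
      using C unfolding int_sqrt_eq_iff[OF irr] comm by simp_all
    show False
      by (rule no_integer_solution[of n "{..<6}" a b p q, unfolded power2_eq_square,
            OF assms(1) _ _ _ yy xx xy]) (use ab pq in simp_all)
  qed
  have "binary_quadratic ?A ?B ?C \<in> forms O\<^sub>F 2 2"
  proof (rule binary_quadratic_in_forms[OF mem(1)])
    \<comment> \<open>Since n + 5 = 2(2k + 3), \<open>?C\<close> has odd numerators 2k + 3 and 1
      over 2.\<close>
    obtain k where k: "n = 1 + 4 * k"
      using assms(3) by (metis add.commute cong_iff_lin cong_sym)
    show "?A \<in> O\<^sub>F"
      using OI[of "3 * n + 77" 26] k by simp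
    show "?B \<in> O\<^sub>F"
      using OI[of "20 + 2 * n" 14] by (simp add: add_divide_distrib)
    show "?C \<in> O\<^sub>F"
    proof -
      have "?C = (of_int (2 * k + 3) + of_int 1 * s) / 2" unfolding k by (simp add: field_simps)
      also have "\<dots> \<in> O\<^sub>F" by (rule OI) simp
      finally show ?thesis .
    qed
  qed
  then have "\<phi> n \<in> Sigma_forms O\<^sub>F 2"
    using seven unfolding Sigma_forms_def \<phi> by blast
  then have "g_invariant O\<^sub>F 2 \<ge> enat (Suc 6)"
    using g_invariant_ge[OF mem(1) _ six] by blast
  moreover have "enat (Suc 6) = 7" by (simp add: numeral_eq_enat)
  ultimately show ?thesis
    using seven six \<phi> unfolding Let_def O\<^sub>F_def[symmetric] binary_quadratic_def s_def by simp
qed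

end
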